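(* Let $\mathbb X$ be a complete separable metric space and let $\eta_1$ be a finite point process on $\mathbb X$ which is negatively associated in sequence (sNA). Suppose that for every bounded Borel set $B\subseteq\mathbb X$ one has $\eta_1(B)<_{cx}Y$, where $Y$ is a random variable with the Poisson distribution $\mathrm{Po}(\mathbb E\eta_1(B))$. Then $\eta_1<_{dcx}\eta_2$, where $\eta_2$ is a Poisson point process on $\mathbb X$ with intensity measure $\mathbb E\eta_1$.
   Context: A point process is a random measure on the Borel sets of $\mathbb X$ that is a counting (integer-valued) measure; it is finite if its total mass is finite. $\mathbb E\eta$ denotes the intensity measure $B\mapsto\mathbb E[\eta(B)]$. sNA: a random vector $(X_1,\dots,X_n)$ is sNA if $\mathrm{Cov}\big(\mathbf 1_{\{X_i>t\}},f(X_{i+1},\dots,X_n)\big)\le0$ for all $i=1,\dots,n-1$, all $t\in\mathbb R$ and all real coordinatewise non-decreasing $f$ for which the covariance exists. A point process $\eta$ is sNA if for every finite collection of disjoint Borel sets $B_1,\dots,B_n$ the vector $(\eta(B_1),\dots,\eta(B_n))$ is sNA. Orders: for real random variables, $X<_{cx}Y$ means $\mathbb E\psi(X)\le\mathbb E\psi(Y)$ for all convex $\psi:\mathbb R\to\mathbb R$ for which the expectations exist. For $f:\mathbb R^n\to\mathbb R$ and $\epsilon>0$ put $\Delta_i^{\epsilon}f(\mathbf x)=f(\mathbf x+\epsilon \mathbf e_i)-f(\mathbf x)$, $\mathbf e_i$ the $i$-th unit vector. $f$ is directionally convex if $\Delta_j^{\delta}\Delta_i^{\epsilon}f(\mathbf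 x)\ge0$ for all $1\le i\le j\le n$, $\epsilon,\delta>0$, $\mathbf x\in\mathbb R^n$. For random vectors, $\mathbf X<_{dcx}\mathbf Y$ means $\mathbb Ef(\mathbf X)\le\mathbb Ef(\mathbf Y)$ for all directionally convex $f$ for which the expectations exist. For point processes on $\mathbb X$, $\eta_1<_{dcx}\eta_2$ means $(\eta_1(B_1),\dots,\eta_1(B_n))<_{dcx}(\eta_2(B_1),\dots,\eta_2(B_n))$ for all $n\ge1$ and all disjoint bounded Borel sets $B_1,\dots,B_n$. *)

theory Defs
  imports "HOL-Probability.Probability"
begin

text \<open>
  Vectors indexed by a finite set \<open>I\<close> of naturals are the extensional functions in
  \<open>I \<rightarrow>\<^sub>E UNIV\<close>, because the dimension is quantified inside the definitions below.
  On this set the order of the function type is the coordinatewise order, so \<^const>\<open>mono_on\<close>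
  expresses ``coordinatewise non-decreasing''.
\<close>

text \<open>The measurability of a composition with a test function \<open>f\<close> is part of \<^const>\<open>integrable\<close>,
  so test functions are not required to be Borel measurable themselves.\<close>

definition cov_exists :: "'w measure \<Rightarrow> ('w \<Rightarrow> real) \<Rightarrow> ('w \<Rightarrow> real) \<Rightarrow> bool" where
  "cov_exists M U V \<longleftrightarrow> integrable M U \<and> integrable M V \<and> integrable M (\<lambda>\<omega>. U \<omega> * V \<omega>)"

definition Cov :: "'w measure \<Rightarrow> ('w \<Rightarrow> real) \<Rightarrow> ('w \<Rightarrow> real) \<Rightarrow> real" where
  "Cov M U V = (\<integral>\<omega>. U \<omega> * V \<omega> \<partial>M) - (\<integral>\<omega>. U \<omega> \<partial>M) * (\<integral>\<omega>. V \<omega> \<partial>M)"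

definition sNA_vector :: "'w measure \<Rightarrow> nat \<Rightarrow> (nat \<Rightarrow> 'w \<Rightarrow> real) \<Rightarrow> bool" where
  "sNA_vector M n X \<longleftrightarrow>
     (\<forall>i\<in>{1..<n}. \<forall>t::real. \<forall>f :: (nat \<Rightarrow> real) \<Rightarrow> real.
        mono_on ({i+1..n} \<rightarrow>\<^sub>E UNIV) f \<longrightarrow>
        cov_exists M (\<lambda>\<omega>. indicator {t<..} (X i \<omega>)) (\<lambda>\<omega>. f (\<lambda>j\<in>{i+1..n}. X j \<omega>)) \<longrightarrow>
        Cov M (\<lambda>\<omega>. indicator {t<..} (X i \<omega>)) (\<lambda>\<omega>. f (\<lambda>j\<in>{i+1..n}. X j \<omega>)) \<le> 0)"

definition cx_less ::
  "'w measure \<Rightarrow> ('w \<Rightarrow> real) \<Rightarrow> 'v measure \<Rightarrow> ('v \<Rightarrow> real) \<Rightarrow> bool" where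
  "cx_less M X N Y \<longleftrightarrow>
     (\<forall>\<psi> :: real \<Rightarrow> real. convex_on UNIV \<psi> \<longrightarrow>
        integrable M (\<lambda>\<omega>. \<psi> (X \<omega>)) \<longrightarrow> integrable N (\<lambda>\<omega>. \<psi> (Y \<omega>)) \<longrightarrow>
        (\<integral>\<omega>. \<psi> (X \<omega>) \<partial>M) \<le> (\<integral>\<omega>. \<psi> (Y \<omega>) \<partial>N))"

definition fdiff :: "nat \<Rightarrow> real \<Rightarrow> ((nat \<Rightarrow> real) \<Rightarrow> real) \<Rightarrow> (nat \<Rightarrow> real) \<Rightarrow> real" where
  "fdiff i \<epsilon> f x = f (x(i := x i + \<epsilon>)) - f x"

definition directionally_convex :: "nat \<Rightarrow> ((nat \<Rightarrow> real) \<Rightarrow> real) \<Rightarrow> bool" where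
  "directionally_convex n f \<longleftrightarrow>
     (\<forall>i j \<epsilon> \<delta>. 1 \<le> i \<longrightarrow> i \<le> j \<longrightarrow> j \<le> n \<longrightarrow> 0 < \<epsilon> \<longrightarrow> 0 < \<delta> \<longrightarrow>
        (\<forall>x \<in> {1..n} \<rightarrow>\<^sub>E UNIV. 0 \<le> fdiff j \<delta> (fdiff i \<epsilon> f) x))"

definition dcx_less_vector ::
  "nat \<Rightarrow> 'w measure \<Rightarrow> (nat \<Rightarrow> 'w \<Rightarrow> real) \<Rightarrow> 'v measure \<Rightarrow> (nat \<Rightarrow> 'v \<Rightarrow> real) \<Rightarrow> bool" where
  "dcx_less_vector n M X N Y \<longleftrightarrow>
     (\<forall>f. directionally_convex n f \<longrightarrow>
        integrable M (\<lambda>\<omega>. f (\<lambda>j\<in>{1..n}. X j \<omega>)) \<longrightarrow>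
        integrable N (\<lambda>\<omega>. f (\<lambda>j\<in>{1..n}. Y j \<omega>)) \<longrightarrow>
        (\<integral>\<omega>. f (\<lambda>j\<in>{1..n}. X j \<omega>) \<partial>M) \<le> (\<integral>\<omega>. f (\<lambda>j\<in>{1..n}. Y j \<omega>) \<partial>N))"

text \<open>Integer values include \<open>\<infinity>\<close>; no local finiteness is imposed.\<close>

definition point_process ::
  "'w measure \<Rightarrow> ('w \<Rightarrow> 'a::topological_space measure) \<Rightarrow> bool" where
  "point_process M \<eta> \<longleftrightarrow> prob_space M \<and>
     (\<forall>\<omega>\<in>space M. sets (\<eta> \<omega>) = sets borel) \<and>
     (\<forall>B\<in>sets borel. (\<lambda>\<omega>. emeasure (\<eta> \<omega>) B) \<in> borel_measurable M) \<and>
     (\<forall>\<omega>\<in>space M. \<forall>B\<in>sets borel. emeasure (\<eta> \<omega>) B \<in> range of_nat \<union> {\<infinity>})"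

definition finite_point_process ::
  "'w measure \<Rightarrow> ('w \<Rightarrow> 'a::topological_space measure) \<Rightarrow> bool" where
  "finite_point_process M \<eta> \<longleftrightarrow> point_process M \<eta> \<and> (AE \<omega> in M. emeasure (\<eta> \<omega>) UNIV < \<infinity>)"

definition intensity_measure ::
  "'w measure \<Rightarrow> ('w \<Rightarrow> 'a::topological_space measure) \<Rightarrow> 'a measure" where
  "intensity_measure M \<eta> =
     measure_of UNIV (sets borel) (\<lambda>B. \<integral>\<^sup>+\<omega>. emeasure (\<eta> \<omega>) B \<partial>M)"

lemma sets_intensity_measure [simp]: "sets (intensity_measure M \<eta>) = sets borel"
  unfolding intensity_measure_def by (metis sets.sets_measure_of_eq space_borel)

lemma emeasure_intensity_measure:
  assumes "point_process M \<eta>" and "B \<in> sets borel"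
  shows "emeasure (intensity_measure M \<eta>) B = (\<integral>\<^sup>+\<omega>. emeasure (\<eta> \<omega>) B \<partial>M)"
proof (rule emeasure_measure_of[OF intensity_measure_def])
  show "countably_additive (sets (intensity_measure M \<eta>)) (\<lambda>B. \<integral>\<^sup>+\<omega>. emeasure (\<eta> \<omega>) B \<partial>M)"
  proof (rule countably_additiveI)
    fix A :: "nat \<Rightarrow> 'b set"
    assume A: "range A \<subseteq> sets (intensity_measure M \<eta>)" "disjoint_family A"
    have "(\<Sum>i. \<integral>\<^sup>+\<omega>. emeasure (\<eta> \<omega>) (A i) \<partial>M) = (\<integral>\<^sup>+\<omega>. (\<Sum>i. emeasure (\<eta> \<omega>) (A i)) \<partial>M)"
      using assms(1) A by (intro nn_integral_suminf[symmetric]) (auto simp: point_process_def)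
    also have "\<dots> = (\<integral>\<^sup>+\<omega>. emeasure (\<eta> \<omega>) (\<Union>i. A i) \<partial>M)"
      using assms(1) A by (intro nn_integral_cong suminf_emeasure) (auto simp: point_process_def)
    finally show "(\<Sum>i. \<integral>\<^sup>+\<omega>. emeasure (\<eta> \<omega>) (A i) \<partial>M)
      = (\<integral>\<^sup>+\<omega>. emeasure (\<eta> \<omega>) (\<Union>i. A i) \<partial>M)" .
  qed
qed (use assms in \<open>auto simp: positive_def\<close>)

text \<open>The Poisson distribution, with \<open>Po(0)\<close> the point mass at \<open>0\<close> (the library's
  \<^const>\<open>poisson_pmf\<close> is only specified for positive rates).\<close>

definition Po :: "real \<Rightarrow> nat pmf" where
  "Po r = (if 0 < r then poisson_pmf r else return_pmf 0)"

text \<open>On sets of infinite intensity the count is \<open>\<infinity>\<close> almost surely, as usual.\<close>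

definition poisson_process ::
  "'w measure \<Rightarrow> ('w \<Rightarrow> 'a::topological_space measure) \<Rightarrow> 'a measure \<Rightarrow> bool" where
  "poisson_process M \<eta> \<Lambda> \<longleftrightarrow> point_process M \<eta> \<and>
     (\<forall>B\<in>sets borel. if emeasure \<Lambda> B < \<infinity>
        then \<forall>k. measure M {\<omega>\<in>space M. emeasure (\<eta> \<omega>) B = of_nat k} = pmf (Po (measure \<Lambda> B)) k
        else AE \<omega> in M. emeasure (\<eta> \<omega>) B = \<infinity>) \<and>
     (\<forall>n. \<forall>B :: nat \<Rightarrow> 'a set. B ` {1..n} \<subseteq> sets borel \<longrightarrow> disjoint_family_on B {1..n} \<longrightarrow>
        prob_space.indep_vars M (\<lambda>_. borel) (\<lambda>i \<omega>. emeasure (\<eta> \<omega>) (B i)) {1..n})"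

text \<open>Counts are turned into reals by \<^const>\<open>measure\<close>, which sends \<open>\<infinity>\<close> to \<open>0\<close>; this is
  harmless here since sNA is only used for almost surely finite processes.\<close>

definition sNA_process ::
  "'w measure \<Rightarrow> ('w \<Rightarrow> 'a::topological_space measure) \<Rightarrow> bool" where
  "sNA_process M \<eta> \<longleftrightarrow>
     (\<forall>n. \<forall>B :: nat \<Rightarrow> 'a set. B ` {1..n} \<subseteq> sets borel \<longrightarrow> disjoint_family_on B {1..n} \<longrightarrow>
        sNA_vector M n (\<lambda>i \<omega>. measure (\<eta> \<omega>) (B i)))"

text \<open>The almost sure finiteness clauses say that the count vectors are real random vectors, so
  that the vector order applies to them.\<close>

definition dcx_less_process ::
  "'w measure \<Rightarrow> ('w \<Rightarrow> 'a::metric_space measure) \<Rightarrow>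
   'v measure \<Rightarrow> ('v \<Rightarrow> 'a measure) \<Rightarrow> bool" where
  "dcx_less_process M \<eta>\<^sub>1 N \<eta>\<^sub>2 \<longleftrightarrow>
     (\<forall>n\<ge>1. \<forall>B :: nat \<Rightarrow> 'a set.
        (\<forall>i\<in>{1..n}. B i \<in> sets borel \<and> bounded (B i)) \<longrightarrow> disjoint_family_on B {1..n} \<longrightarrow>
        (\<forall>i\<in>{1..n}. AE \<omega> in M. emeasure (\<eta>\<^sub>1 \<omega>) (B i) < \<infinity>) \<and>
        (\<forall>i\<in>{1..n}. AE \<omega> in N. emeasure (\<eta>\<^sub>2 \<omega>) (B i) < \<infinity>) \<and>
        dcx_less_vector n M (\<lambda>i \<omega>. measure (\<eta>\<^sub>1 \<omega>) (B i)) N (\<lambda>i \<omega>. measure (\<eta>\<^sub>2 \<omega>) (B i)))"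

end

theory Submission
  imports Defs
begin

text \<open>
  Every count is a natural number, so a test function matters only on vectors of naturals. There
  a directionally convex \<open>f\<close> has increments \<open>\<Delta>\<^sub>i f\<close> that are non-decreasing in every coordinate, so
  \<open>f(x) - f(0) - (\<Sum>i. x\<^sub>i * \<Delta>\<^sub>i f(0))\<close> is non-negative and non-decreasing, and still directionally
  convex. The convex order between the one-dimensional counts forces equal means, hence the
  subtracted affine function has the same expectation under both count vectors, and it is enough
  to treat non-negative non-decreasing \<open>f\<close>. For these every expectation exists in \<open>[0, \<infinity>]\<close>. This
  settles the integrability question: \<open>f\<close> is only known to be integrable for the two end points
  of the comparison, but the argument passes through hybrid vectors with some coordinates already
  Poisson, for which nothing is known.

  The coordinates are replaced one after the other, the first one first (lemma
  \<open>sNA_replace_coordinate\<close>). Let the coordinates before \<open>i\<close> be fixed and let \<open>H t x\<close> be \<open>f\<close> with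
  \<open>i\<close>-th argument \<open>t\<close> and later arguments taken from \<open>x\<close>. Then
  \<open>H (X\<^sub>i) X = H 0 X + (\<Sum>t. 1{X\<^sub>i > t} * (H (t+1) X - H t X))\<close>, a sum of products of a tail indicator
  of \<open>X\<^sub>i\<close> with a non-decreasing function of the later coordinates. By sNA each product has
  expectation at most the product of the expectations, so \<open>X\<^sub>i\<close> may be replaced by an independent
  copy. Now the later coordinates can be fixed, too; \<open>H\<close> is convex in \<open>t\<close>, hence a
  combination of a constant and the functions \<open>t \<mapsto> (t - k)\<^sup>+\<close> with non-negative weights, and the
  convex order lets the copy be replaced by an independent Poisson variable. After
  the last coordinate the vector consists of independent Poisson variables
  (\<open>sNA_pmf_le_independent\<close>), which is the law of the counts of the Poisson process
  (\<open>law_of_poisson_count_vector\<close>).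
\<close>

section \<open>Directional convexity on vectors of natural numbers\<close>

text \<open>
  The vectors of length \<open>n\<close>. Padding by \<open>0\<close>, instead of by an undefined value, makes these
  the vectors on which \<^term>\<open>Pi_pmf {1..n} 0\<close> lives.
\<close>

definition grid :: "nat \<Rightarrow> (nat \<Rightarrow> nat) set" where
  "grid n = {x. \<forall>j. j \<notin> {1..n} \<longrightarrow> x j = 0}"

definition increment :: "nat \<Rightarrow> ((nat \<Rightarrow> nat) \<Rightarrow> real) \<Rightarrow> (nat \<Rightarrow> nat) \<Rightarrow> real" where
  "increment i F x = F (x(i := Suc (x i))) - F x"

definition grid_dcx :: "nat \<Rightarrow> ((nat \<Rightarrow> nat) \<Rightarrow> real) \<Rightarrow> bool" where
  "grid_dcx n F \<longleftrightarrow>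
     (\<forall>i\<in>{1..n}. \<forall>j\<in>{1..n}. \<forall>x\<in>grid n. 0 \<le> increment j (increment i F) x)"

text \<open>
  The hybrid vectors: those coordinates up to \<open>k\<close> have been replaced. With \<open>y = 0\<close> the function
  forgets these coordinates and so selects the tail of \<open>x\<close> that enters the definition of sNA.
\<close>

definition graft :: "nat \<Rightarrow> (nat \<Rightarrow> nat) \<Rightarrow> (nat \<Rightarrow> nat) \<Rightarrow> nat \<Rightarrow> nat" where
  "graft k y x = (\<lambda>j. if j \<le> k then y j else x j)"

lemma zero_in_grid [simp]: "(\<lambda>_. 0) \<in> grid n"
  by (simp add: grid_def)

lemma fun_upd_in_grid: "x \<in> grid n \<Longrightarrow> j \<in> {1..n} \<Longrightarrow> x(j := k) \<in> grid n"
  by (auto simp: grid_def)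

lemma graft_in_grid: "y \<in> grid n \<Longrightarrow> x \<in> grid n \<Longrightarrow> graft k y x \<in> grid n"
  by (auto simp: grid_def graft_def)

lemma graft_mono: "x \<le> x' \<Longrightarrow> graft k y x \<le> graft k y x'"
  by (auto simp: graft_def le_fun_def)

lemma graft_graft: "graft k y (graft k z x) = graft k y x"
  by (auto simp: graft_def)

lemma graft_Suc_upd: "graft (Suc k) (y(Suc k := x (Suc k))) x = graft k y x"
  by (auto simp: graft_def le_Suc_eq)

lemma graft_upd: "(graft i (y(i := t)) x)(i := s) = graft i (y(i := s)) x"
  by (auto simp: graft_def)

lemma countable_grid: "countable (grid n)"
proof -
  have "grid n \<subseteq> (\<lambda>x j. if j \<in> {1..n} then x j else 0) ` ({1..n} \<rightarrow>\<^sub>E UNIV)"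
  proof
    fix x assume "x \<in> grid n"
    then have "x = (\<lambda>j. if j \<in> {1..n} then restrict x {1..n} j else 0)"
      by (auto simp: grid_def)
    then show "x \<in> (\<lambda>x j. if j \<in> {1..n} then x j else 0) ` ({1..n} \<rightarrow>\<^sub>E UNIV)"
      by (rule image_eqI[where x = "restrict x {1..n}"]) simp
  qed
  moreover have "countable ({1..n} \<rightarrow>\<^sub>E (UNIV :: nat set))"
    by (intro countable_PiE) auto
  ultimately show ?thesis
    by (meson countable_image countable_subset)
qed

lemma mono_on_grid_if_increments_nonneg:
  assumes inc: "\<And>j x. j \<in> {1..n} \<Longrightarrow> x \<in> grid n \<Longrightarrow> 0 \<le> increment j F x"
  shows "mono_on (grid n) F"
proof (rule mono_onI)
  fix x y :: "nat \<Rightarrow> nat" assume "x \<in> grid n" "y \<in> grid n" "x \<le> y"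
  then show "F x \<le> F y"
  proof (induction "\<Sum>j\<in>{1..n}. y j - x j" arbitrary: x rule: less_induct)
    case less
    show ?case
    proof (cases "x = y")
      case False
      then obtain j where j: "x j \<noteq> y j" by auto
      then have jn: "j \<in> {1..n}" using less.prems(1,2) by (metis (mono_tags, lifting) grid_def mem_Collect_eq)
      have lt: "x j < y j" using j less.prems(3) by (simp add: le_fun_def order.not_eq_order_implies_strict)
      let ?x = "x(j := Suc (x j))"
      have "(\<Sum>i\<in>{1..n}. y i - ?x i) < (\<Sum>i\<in>{1..n}. y i - x i)"
        using jn lt by (intro sum_strict_mono_ex1) auto
      moreover have "?x \<le> y" using less.prems(3) lt by (auto simp: le_fun_def)
      ultimately have "F ?x \<le> F y"
        using less.hyps less.prems jn by (simp add: fun_upd_in_grid)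
      then show ?thesis using inc[OF jn less.prems(1)] by (simp add: increment_def)
    qed simp
  qed
qed

lemma increment_commute: "increment j (increment i F) x = increment i (increment j F) x"
  by (cases "i = j") (simp_all add: increment_def fun_upd_twist)

text \<open>
  Unit steps suffice. Directional convexity only speaks about \<open>i \<le> j\<close>; the other pairs follow
  because difference operators commute.
\<close>

lemma grid_dcx_if_directionally_convex:
  assumes "directionally_convex n f"
  shows "grid_dcx n (\<lambda>x. f (\<lambda>j\<in>{1..n}. real (x j)))"
proof -
  let ?r = "\<lambda>x :: nat \<Rightarrow> nat. \<lambda>j\<in>{1..n}. real (x j)" and ?F = "\<lambda>x. f (\<lambda>j\<in>{1..n}. real (x j))"
  have r: "?r (x(i := Suc (x i))) = (?r x)(i := ?r x i + 1)" if "i \<in> {1..n}" for x i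
    using that by (auto simp: fun_eq_iff)
  have eq: "increment j (increment i ?F) x = fdiff j 1 (fdiff i 1 f) (?r x)"
    if "i \<in> {1..n}" "j \<in> {1..n}" for i j x
    by (simp only: increment_def fdiff_def r that)
  have le: "0 \<le> increment j (increment i ?F) x" if "i \<in> {1..n}" "j \<in> {1..n}" "i \<le> j" for i j x
    using assms that unfolding eq[OF that(1,2)] directionally_convex_def by simp
  show ?thesis
    unfolding grid_dcx_def
  proof (intro ballI)
    fix i j x assume "i \<in> {1..n}" "j \<in> {1..n}"
    then show "0 \<le> increment j (increment i ?F) x"
      using le[of i j x] le[of j i x] by (cases "i \<le> j") (simp_all add: increment_commute[of j i])
  qed
qed

section \<open>Series expansions of functions of one count\<close>

text \<open>
  Telescoping: the increment from \<open>t\<close> to \<open>t + 1\<close> is picked up exactly when \<open>x > t\<close>.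
\<close>

lemma nat_function_layer_cake:
  fixes g :: "nat \<Rightarrow> real"
  assumes "0 \<le> g 0" "\<And>t. g t \<le> g (Suc t)"
  shows "ennreal (g x) = ennreal (g 0) + (\<Sum>t. indicator {t<..} x * ennreal (g (Suc t) - g t))"
proof -
  have "(\<Sum>t. indicator {t<..} x * ennreal (g (Suc t) - g t)) =
        (\<Sum>t\<in>{..<x}. indicator {t<..} x * ennreal (g (Suc t) - g t))"
    by (rule suminf_finite) auto
  also have "\<dots> = (\<Sum>t\<in>{..<x}. ennreal (g (Suc t) - g t))"
    by (intro sum.cong) auto
  also have "\<dots> = ennreal (\<Sum>t\<in>{..<x}. g (Suc t) - g t)"
    using assms by (intro sum_ennreal) auto
  also have "(\<Sum>t\<in>{..<x}. g (Suc t) - g t) = g x - g 0"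
    by (rule sum_lessThan_telescope)
  finally show ?thesis
    using assms lift_Suc_mono_le[of g 0 x] by (simp flip: ennreal_plus)
qed

text \<open>
  A discrete Taylor expansion: the weight of \<open>(x - k)\<^sup>+\<close> is the change of slope at \<open>k\<close>, which
  convexity makes non-negative. The linear part needs no separate treatment: it is the term
  \<open>k = 0\<close>, whose weight is the initial slope.
\<close>

lemma convex_nat_function_stop_loss:
  fixes g :: "nat \<Rightarrow> real"
  assumes "0 \<le> g 0" "0 \<le> g 1 - g 0" "\<And>t. g (Suc t) - g t \<le> g (Suc (Suc t)) - g (Suc t)"
  shows "\<exists>a :: nat \<Rightarrow> ennreal. \<forall>x. ennreal (g x) = ennreal (g 0) + (\<Sum>k. a k * of_nat (x - k))"
proof -
  define a where "a k = (case k of 0 \<Rightarrow> g 1 - g 0 | Suc l \<Rightarrow> (g (Suc (Suc l)) - g (Suc l)) - (g (Suc l) - g l))" for k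
  have a0: "0 \<le> a k" for k
    using assms(2) assms(3)[of "k - 1"] by (cases k) (simp_all add: a_def)
  have slope: "(\<Sum>k\<le>x. a k) = g (Suc x) - g x" for x
    by (induction x) (auto simp: a_def)
  have *: "g x = g 0 + (\<Sum>k<x. a k * real (x - k))" for x
  proof (induction x)
    case (Suc x)
    have "(\<Sum>k<Suc x. a k * real (Suc x - k)) = (\<Sum>k<Suc x. a k * real (x - k) + a k)"
      by (intro sum.cong) (auto simp: algebra_simps Suc_diff_le)
    also have "\<dots> = (\<Sum>k<x. a k * real (x - k)) + (\<Sum>k\<le>x. a k)"
      by (simp add: sum.distrib lessThan_Suc_atMost[symmetric])
    finally show ?case using Suc slope[of x] by simp
  qed simp
  have "ennreal (g x) = ennreal (g 0) + (\<Sum>k. ennreal (a k) * of_nat (x - k))" for x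
  proof -
    have "(\<Sum>k. ennreal (a k) * of_nat (x - k)) = (\<Sum>k<x. ennreal (a k) * of_nat (x - k))"
      by (rule suminf_finite) auto
    also have "\<dots> = (\<Sum>k<x. ennreal (a k * real (x - k)))"
      using a0 by (simp add: ennreal_mult' ennreal_of_nat_eq_real_of_nat)
    also have "\<dots> = ennreal (\<Sum>k<x. a k * real (x - k))"
      using a0 by (intro sum_ennreal) auto
    finally show ?thesis
      using *[of x] assms(1) a0 ennreal_plus[of "g 0" "\<Sum>k<x. a k * real (x - k)"]
      by (simp add: sum_nonneg del: ennreal_plus of_nat_diff_real of_nat_diff)
  qed
  then show ?thesis by (intro exI[of _ "\<lambda>k. ennreal (a k)"]) blast
qed

text \<open>
  For non-negative non-decreasing convex functions the order of the stop-loss integrals \<open>E(X - k)\<^sup>+\<close>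
  decides, even when the integrals of \<open>g\<close> are infinite.
\<close>

lemma nn_integral_stop_loss_mono:
  fixes g :: "nat \<Rightarrow> real" and p q :: "nat pmf"
  assumes g: "0 \<le> g 0" "0 \<le> g 1 - g 0" "\<And>t. g (Suc t) - g t \<le> g (Suc (Suc t)) - g (Suc t)"
    and le: "\<And>k. (\<integral>\<^sup>+x. of_nat (x - k) \<partial>p) \<le> (\<integral>\<^sup>+x. of_nat (x - k) \<partial>q)"
  shows "(\<integral>\<^sup>+x. ennreal (g x) \<partial>p) \<le> (\<integral>\<^sup>+x. ennreal (g x) \<partial>q)"
proof -
  obtain a :: "nat \<Rightarrow> ennreal" where a: "\<And>x. ennreal (g x) = ennreal (g 0) + (\<Sum>k. a k * of_nat (x - k))"
    using convex_nat_function_stop_loss[OF g] by blast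
  have eq: "(\<integral>\<^sup>+x. ennreal (g x) \<partial>r) = ennreal (g 0) + (\<Sum>k. a k * (\<integral>\<^sup>+x. of_nat (x - k) \<partial>r))" for r :: "nat pmf"
    by (subst a) (simp add: nn_integral_add nn_integral_suminf nn_integral_cmult measure_pmf.emeasure_space_1[simplified])
  show ?thesis
    unfolding eq by (intro add_left_mono suminf_le mult_left_mono le) auto
qed

section \<open>Replacing dependent coordinates by independent ones\<close>

lemma nn_integral_pmf_swap:
  fixes f :: "'c \<Rightarrow> 'd \<Rightarrow> ennreal"
  shows "(\<integral>\<^sup>+x. \<integral>\<^sup>+y. f x y \<partial>measure_pmf q \<partial>measure_pmf p) = (\<integral>\<^sup>+y. \<integral>\<^sup>+x. f x y \<partial>measure_pmf p \<partial>measure_pmf q)"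
proof -
  have "(\<integral>\<^sup>+x. \<integral>\<^sup>+y. f x y \<partial>measure_pmf q \<partial>measure_pmf p) = (\<integral>\<^sup>+z. f (fst z) (snd z) \<partial>pair_pmf p q)"
    by (simp add: nn_integral_pair_pmf')
  also have "pair_pmf p q = map_pmf (\<lambda>(x, y). (y, x)) (pair_pmf q p)"
    by (rule pair_commute_pmf)
  also have "(\<integral>\<^sup>+z. f (fst z) (snd z) \<partial>map_pmf (\<lambda>(x, y). (y, x)) (pair_pmf q p)) = (\<integral>\<^sup>+y. \<integral>\<^sup>+x. f x y \<partial>measure_pmf p \<partial>measure_pmf q)"
    by (simp add: nn_integral_pair_pmf')
  finally show ?thesis .
qed

text \<open>
  Negative association in sequence for a law on the grid. Test functions with values in
  \<open>[0, \<infinity>]\<close> cover all non-negative monotone ones at once, integrable or not.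
\<close>

definition sNA_pmf :: "nat \<Rightarrow> (nat \<Rightarrow> nat) pmf \<Rightarrow> bool" where
  "sNA_pmf n P \<longleftrightarrow>
     (\<forall>i\<in>{1..n}. \<forall>t. \<forall>h :: (nat \<Rightarrow> nat) \<Rightarrow> ennreal. mono_on (grid n) h \<longrightarrow>
        (\<integral>\<^sup>+x. indicator {t<..} (x i) * h (graft i (\<lambda>_. 0) x) \<partial>P)
          \<le> (\<integral>\<^sup>+x. indicator {t<..} (x i) \<partial>P) * (\<integral>\<^sup>+x. h (graft i (\<lambda>_. 0) x) \<partial>P))"

text \<open>
  One step of the replacement. sNA separates the \<open>i\<close>-th coordinate from the later ones in each
  term of the layer-cake sum; once they are independent, the integral over the \<open>i\<close>-th coordinate
  can be taken first, and convexity in that coordinate applies.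
\<close>

lemma sNA_replace_coordinate:
  fixes q :: "nat pmf"
  assumes P: "set_pmf P \<subseteq> grid n" "sNA_pmf n P"
    and le: "\<And>k. (\<integral>\<^sup>+x. of_nat (x i - k) \<partial>P) \<le> (\<integral>\<^sup>+z. of_nat (z - k) \<partial>q)"
    and i: "i \<in> {1..n}" "i = Suc l"
    and F: "grid_dcx n F" "mono_on (grid n) F" "0 \<le> F (\<lambda>_. 0)"
    and y: "y \<in> grid n"
  shows "(\<integral>\<^sup>+x. ennreal (F (graft l y x)) \<partial>P)
           \<le> (\<integral>\<^sup>+z. \<integral>\<^sup>+x. ennreal (F (graft i (y(i := z)) x)) \<partial>P \<partial>q)"
proof -
  define H where "H t x = F (graft i (y(i := t)) x)" for t x
  have in_grid: "graft i (y(i := t)) x \<in> grid n" if "x \<in> grid n" for t x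
    using y that i by (intro graft_in_grid fun_upd_in_grid)
  have step: "H (Suc t) x - H t x = increment i F (graft i (y(i := t)) x)" for t x
    using graft_upd[of i y t x "Suc t"] by (simp add: H_def increment_def graft_def)
  have H0: "0 \<le> H t x" if "x \<in> grid n" for t x
    using order_trans[OF F(3) mono_onD[OF F(2) zero_in_grid in_grid[OF that]]]
    by (simp add: H_def le_fun_def)
  have Hmono: "H t x \<le> H (Suc t) x" if "x \<in> grid n" for t x
    unfolding H_def using that by (intro mono_onD[OF F(2)] in_grid) (auto simp: graft_def le_fun_def)
  have Hconvex: "H (Suc t) x - H t x \<le> H (Suc (Suc t)) x - H (Suc t) x" if "x \<in> grid n" for t x
  proof -
    have "0 \<le> increment i (increment i F) (graft i (y(i := t)) x)"
      using F(1) i in_grid[OF that] unfolding grid_dcx_def by blast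
    then show ?thesis
      unfolding step by (subst (asm) increment_def) (simp add: graft_upd, simp add: graft_def)
  qed
  \<comment> \<open>The test functions for sNA: monotone in the later coordinates by the mixed differences.\<close>
  have Dmono: "mono_on (grid n) (\<lambda>x. ennreal (H (Suc t) x - H t x))" for t
  proof (rule mono_onI, rule ennreal_leI)
    have *: "mono_on (grid n) (increment i F)"
      using F(1) i by (intro mono_on_grid_if_increments_nonneg) (auto simp: grid_dcx_def)
    show "H (Suc t) x - H t x \<le> H (Suc t) x' - H t x'"
      if "x \<in> grid n" "x' \<in> grid n" "x \<le> x'" for x x'
      unfolding step using that by (intro mono_onD[OF *] in_grid graft_mono)
  qed
  \<comment> \<open>They depend on the later coordinates only.\<close>
  have Htail: "H t (graft i (\<lambda>_. 0) x) = H t x" for t x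
    by (simp add: H_def graft_graft)
  have cake: "ennreal (H s x) = ennreal (H 0 x) + (\<Sum>t. indicator {t<..} s * ennreal (H (Suc t) x - H t x))"
    if "x \<in> grid n" for s x
    using H0 Hmono that by (intro nat_function_layer_cake) auto
  have AE_grid: "AE x in P. x \<in> grid n"
    using P(1) by (auto simp: AE_measure_pmf_iff)
  have "(\<integral>\<^sup>+x. ennreal (F (graft l y x)) \<partial>P) = (\<integral>\<^sup>+x. ennreal (H (x i) x) \<partial>P)"
    by (simp add: H_def i(2) graft_Suc_upd)
  also have "\<dots> = (\<integral>\<^sup>+x. ennreal (H 0 x) + (\<Sum>t. indicator {t<..} (x i) * ennreal (H (Suc t) x - H t x)) \<partial>P)"
    by (rule nn_integral_cong_AE, use AE_grid in eventually_elim) (rule cake)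
  also have "\<dots> = (\<integral>\<^sup>+x. ennreal (H 0 x) \<partial>P) + (\<Sum>t. \<integral>\<^sup>+x. indicator {t<..} (x i) * ennreal (H (Suc t) x - H t x) \<partial>P)"
    by (simp add: nn_integral_add nn_integral_suminf)
  also have "\<dots> \<le> (\<integral>\<^sup>+x. ennreal (H 0 x) \<partial>P) + (\<Sum>t. (\<integral>\<^sup>+x. indicator {t<..} (x i) \<partial>P) * (\<integral>\<^sup>+x. ennreal (H (Suc t) x - H t x) \<partial>P))"
  proof (intro add_left_mono suminf_le)
    fix t
    show "(\<integral>\<^sup>+x. indicator {t<..} (x i) * ennreal (H (Suc t) x - H t x) \<partial>P)
        \<le> (\<integral>\<^sup>+x. indicator {t<..} (x i) \<partial>P) * (\<integral>\<^sup>+x. ennreal (H (Suc t) x - H t x) \<partial>P)"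
      using P(2)[unfolded sNA_pmf_def, rule_format, OF i(1) Dmono[of t], of t] by (simp only: Htail)
  qed auto
  also have "\<dots> = (\<integral>\<^sup>+x'. \<integral>\<^sup>+x. ennreal (H 0 x) + (\<Sum>t. indicator {t<..} (x' i) * ennreal (H (Suc t) x - H t x)) \<partial>P \<partial>P)"
    by (simp add: nn_integral_add nn_integral_suminf nn_integral_cmult nn_integral_multc measure_pmf.emeasure_space_1[simplified])
  also have "\<dots> = (\<integral>\<^sup>+x'. \<integral>\<^sup>+x. ennreal (H (x' i) x) \<partial>P \<partial>P)"
    by (rule nn_integral_cong, rule nn_integral_cong_AE, use AE_grid in eventually_elim)
      (rule cake[symmetric])
  also have "\<dots> = (\<integral>\<^sup>+x. \<integral>\<^sup>+x'. ennreal (H (x' i) x) \<partial>P \<partial>P)"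
    by (rule nn_integral_pmf_swap)
  also have "\<dots> \<le> (\<integral>\<^sup>+x. \<integral>\<^sup>+z. ennreal (H z x) \<partial>q \<partial>P)"
  proof (rule nn_integral_mono_AE, use AE_grid in eventually_elim)
    fix x assume x: "x \<in> grid n"
    have "(\<integral>\<^sup>+x'. ennreal (H (x' i) x) \<partial>P) = (\<integral>\<^sup>+s. ennreal (H s x) \<partial>map_pmf (\<lambda>x'. x' i) P)"
      by simp
    also have "\<dots> \<le> (\<integral>\<^sup>+z. ennreal (H z x) \<partial>q)"
      using H0[OF x] Hmono[OF x, of 0] Hconvex[OF x] le by (intro nn_integral_stop_loss_mono) auto
    finally show "(\<integral>\<^sup>+x'. ennreal (H (x' i) x) \<partial>P) \<le> (\<integral>\<^sup>+z. ennreal (H z x) \<partial>q)" .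
  qed
  also have "\<dots> = (\<integral>\<^sup>+z. \<integral>\<^sup>+x. ennreal (H z x) \<partial>P \<partial>q)"
    by (rule nn_integral_pmf_swap)
  finally show ?thesis by (simp add: H_def)
qed

text \<open>
  The induction runs over the number \<open>k\<close> of coordinates already replaced. The new coordinates
  are averaged outside, so that each step works with a fixed \<open>y\<close> and leaves the joint law of the
  remaining old coordinates untouched.
\<close>

lemma sNA_pmf_le_independent:
  fixes p :: "nat \<Rightarrow> nat pmf"
  assumes P: "set_pmf P \<subseteq> grid n" "sNA_pmf n P"
    and le: "\<And>i k. i \<in> {1..n} \<Longrightarrow> (\<integral>\<^sup>+x. of_nat (x i - k) \<partial>P) \<le> (\<integral>\<^sup>+z. of_nat (z - k) \<partial>p i)"
    and F: "grid_dcx n F" "mono_on (grid n) F" "0 \<le> F (\<lambda>_. 0)"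
  shows "(\<integral>\<^sup>+x. ennreal (F x) \<partial>P) \<le> (\<integral>\<^sup>+y. ennreal (F y) \<partial>Pi_pmf {1..n} 0 p)"
proof -
  have graft_0: "graft 0 (\<lambda>_. 0) x = x" if "x \<in> grid n" for x
    using that by (auto simp: graft_def grid_def)
  have hybrid: "(\<integral>\<^sup>+x. ennreal (F x) \<partial>P) \<le> (\<integral>\<^sup>+y. \<integral>\<^sup>+x. ennreal (F (graft k y x)) \<partial>P \<partial>Pi_pmf {1..k} 0 p)"
    if "k \<le> n" for k
    using that
  proof (induction k)
    case 0
    have "(\<integral>\<^sup>+x. ennreal (F x) \<partial>P) = (\<integral>\<^sup>+x. ennreal (F (graft 0 (\<lambda>_. 0) x)) \<partial>P)"
      using P(1) graft_0 by (intro nn_integral_cong_AE) (auto simp: AE_measure_pmf_iff)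
    then show ?case by (simp add: nn_integral_return)
  next
    case (Suc k)
    have "(\<integral>\<^sup>+x. ennreal (F x) \<partial>P) \<le> (\<integral>\<^sup>+y. \<integral>\<^sup>+x. ennreal (F (graft k y x)) \<partial>P \<partial>Pi_pmf {1..k} 0 p)"
      using Suc by simp
    also have "\<dots> \<le> (\<integral>\<^sup>+y. \<integral>\<^sup>+z. \<integral>\<^sup>+x. ennreal (F (graft (Suc k) (y(Suc k := z)) x)) \<partial>P \<partial>p (Suc k) \<partial>Pi_pmf {1..k} 0 p)"
    proof (rule nn_integral_mono_AE, unfold AE_measure_pmf_iff, rule ballI)
      fix y assume "y \<in> set_pmf (Pi_pmf {1..k} 0 p)"
      then have "y \<in> grid n"
        using set_Pi_pmf_subset[of "{1..k}" 0 p] Suc.prems by (force simp: grid_def)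
      then show "(\<integral>\<^sup>+x. ennreal (F (graft k y x)) \<partial>P)
          \<le> (\<integral>\<^sup>+z. \<integral>\<^sup>+x. ennreal (F (graft (Suc k) (y(Suc k := z)) x)) \<partial>P \<partial>p (Suc k))"
        using Suc.prems le by (intro sNA_replace_coordinate[OF P _ _ _ F]) auto
    qed
    also have "\<dots> = (\<integral>\<^sup>+z. \<integral>\<^sup>+y. \<integral>\<^sup>+x. ennreal (F (graft (Suc k) (y(Suc k := z)) x)) \<partial>P \<partial>Pi_pmf {1..k} 0 p \<partial>p (Suc k))"
      by (rule nn_integral_pmf_swap)
    also have "\<dots> = (\<integral>\<^sup>+y. \<integral>\<^sup>+x. ennreal (F (graft (Suc k) y x)) \<partial>P \<partial>Pi_pmf {1..Suc k} 0 p)"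
      by (simp add: atLeastAtMostSuc_conv Pi_pmf_insert nn_integral_pair_pmf')
    finally show ?case .
  qed
  have "(\<integral>\<^sup>+y. \<integral>\<^sup>+x. ennreal (F (graft n y x)) \<partial>P \<partial>Pi_pmf {1..n} 0 p) = (\<integral>\<^sup>+y. \<integral>\<^sup>+x. ennreal (F y) \<partial>P \<partial>Pi_pmf {1..n} 0 p)"
  proof (intro nn_integral_cong_AE, unfold AE_measure_pmf_iff, intro ballI nn_integral_cong_AE, unfold AE_measure_pmf_iff, intro ballI)
    fix x y assume "x \<in> set_pmf P" "y \<in> set_pmf (Pi_pmf {1..n} 0 p)"
    then have "x \<in> grid n" "y \<in> grid n"
      using P(1) set_Pi_pmf_subset[of "{1..n}" 0 p] by (auto simp: grid_def)
    then have "graft n y x = y" by (auto simp: graft_def grid_def)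
    then show "ennreal (F (graft n y x)) = ennreal (F y)" by simp
  qed
  then show ?thesis
    using hybrid[of n] by (simp add: measure_pmf.emeasure_space_1[simplified])
qed

text \<open>
  The reduction to the monotone case: subtracting the affine function \<open>L\<close> that has the same value
  and the same increments as \<open>F\<close> at \<open>0\<close> makes \<open>F\<close> non-negative and non-decreasing, and by
  equality of the means \<open>L\<close> contributes the same to both sides.
\<close>

lemma sNA_pmf_dcx_le_independent:
  fixes p :: "nat \<Rightarrow> nat pmf"
  assumes P: "set_pmf P \<subseteq> grid n" "sNA_pmf n P"
    and le: "\<And>i k. i \<in> {1..n} \<Longrightarrow> (\<integral>\<^sup>+x. of_nat (x i - k) \<partial>P) \<le> (\<integral>\<^sup>+z. of_nat (z - k) \<partial>p i)"
    and int: "\<And>i. i \<in> {1..n} \<Longrightarrow> integrable P (\<lambda>x. real (x i))" "\<And>i. i \<in> {1..n} \<Longrightarrow> integrable (p i) real"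
    and mean: "\<And>i. i \<in> {1..n} \<Longrightarrow> (\<integral>x. real (x i) \<partial>P) = (\<integral>z. real z \<partial>p i)"
    and F: "grid_dcx n F" "integrable P F" "integrable (Pi_pmf {1..n} 0 p) F"
  shows "(\<integral>x. F x \<partial>P) \<le> (\<integral>y. F y \<partial>Pi_pmf {1..n} 0 p)"
proof -
  let ?Q = "Pi_pmf {1..n} 0 p"
  define c where "c i = increment i F (\<lambda>_. 0)" for i
  define L where "L x = F (\<lambda>_. 0) + (\<Sum>i\<in>{1..n}. c i * real (x i))" for x
  define G where "G x = F x - L x" for x
  have L_increment: "L (x(j := Suc (x j))) - L x = c j" if "j \<in> {1..n}" for j x
  proof -
    have "L (x(j := Suc (x j))) - L x = (\<Sum>i\<in>{1..n}. c i * (real ((x(j := Suc (x j))) i) - real (x i)))"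
      by (simp add: L_def sum_subtractf right_diff_distrib)
    also have "\<dots> = (\<Sum>i\<in>{1..n}. if i = j then c j else 0)"
      by (intro sum.cong) auto
    finally show ?thesis using that by simp
  qed
  have G_increment: "increment j G x = increment j F x - c j" if "j \<in> {1..n}" for j x
    using L_increment[OF that, of x] by (simp add: increment_def G_def)
  have G_dcx: "grid_dcx n G"
    unfolding grid_dcx_def
  proof (intro ballI)
    fix i j x assume ij: "i \<in> {1..n}" "j \<in> {1..n}" "x \<in> grid n"
    have "increment j (increment i G) x = increment j (increment i F) x"
      using G_increment[OF ij(1)] by (simp add: increment_def[of j])
    then show "0 \<le> increment j (increment i G) x"
      using F(1) ij by (simp add: grid_dcx_def)
  qed
  have G_mono: "mono_on (grid n) G"
  proof (rule mono_on_grid_if_increments_nonneg)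
    fix j x assume j: "j \<in> {1..n}" and x: "x \<in> grid n"
    have *: "mono_on (grid n) (increment j F)"
      using F(1) j by (intro mono_on_grid_if_increments_nonneg) (auto simp: grid_dcx_def)
    have "c j \<le> increment j F x"
      unfolding c_def using x by (intro mono_onD[OF * zero_in_grid]) (auto simp: le_fun_def)
    then show "0 \<le> increment j G x" using G_increment[OF j] by simp
  qed
  have G_0: "G (\<lambda>_. 0) = 0" by (simp add: G_def L_def)
  have G_nonneg: "0 \<le> G x" if "x \<in> grid n" for x
    using mono_onD[OF G_mono zero_in_grid that] G_0 by (simp add: le_fun_def)
  have marginal: "map_pmf (\<lambda>y. y i) ?Q = p i" if "i \<in> {1..n}" for i
    using that by (simp add: Pi_pmf_component)
  have int_Q: "integrable ?Q (\<lambda>y. real (y i))" if "i \<in> {1..n}" for i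
    using int(2)[OF that] unfolding marginal[OF that, symmetric] by simp
  have mean_Q: "(\<integral>y. real (y i) \<partial>?Q) = (\<integral>z. real z \<partial>p i)" if "i \<in> {1..n}" for i
    unfolding marginal[OF that, symmetric] by simp
  have L_integral: "integrable R L" "(\<integral>x. L x \<partial>R) = F (\<lambda>_. 0) + (\<Sum>i\<in>{1..n}. c i * (\<integral>x. real (x i) \<partial>R))"
    if "\<And>i. i \<in> {1..n} \<Longrightarrow> integrable R (\<lambda>x. real (x i))" for R :: "(nat \<Rightarrow> nat) pmf"
  proof -
    have sum: "integrable R (\<lambda>x. \<Sum>i\<in>{1..n}. c i * real (x i))"
      using that by (intro Bochner_Integration.integrable_sum integrable_mult_right)
    then show "integrable R L"
      unfolding L_def by (intro Bochner_Integration.integrable_add) auto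
    have "(\<integral>x. L x \<partial>R) = F (\<lambda>_. 0) + (\<integral>x. (\<Sum>i\<in>{1..n}. c i * real (x i)) \<partial>R)"
      unfolding L_def using sum by (subst Bochner_Integration.integral_add) auto
    also have "(\<integral>x. (\<Sum>i\<in>{1..n}. c i * real (x i)) \<partial>R) = (\<Sum>i\<in>{1..n}. \<integral>x. c i * real (x i) \<partial>R)"
      using that by (intro Bochner_Integration.integral_sum integrable_mult_right)
    finally show "(\<integral>x. L x \<partial>R) = F (\<lambda>_. 0) + (\<Sum>i\<in>{1..n}. c i * (\<integral>x. real (x i) \<partial>R))"
      by simp
  qed
  have L_P: "integrable P L" and L_Q: "integrable ?Q L"
    using L_integral(1) int(1) int_Q by blast+
  have L_eq: "(\<integral>x. L x \<partial>P) = (\<integral>y. L y \<partial>?Q)"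
    using L_integral(2)[OF int(1)] L_integral(2)[OF int_Q] mean mean_Q by simp
  have AE_P: "AE x in P. 0 \<le> G x"
    using P(1) G_nonneg by (auto simp: AE_measure_pmf_iff)
  have AE_Q: "AE y in ?Q. 0 \<le> G y"
    using set_Pi_pmf_subset[of "{1..n}" 0 p] G_nonneg by (force simp: AE_measure_pmf_iff grid_def)
  have GP: "integrable P G" and GQ: "integrable ?Q G"
    unfolding G_def using F L_P L_Q by auto
  have "(\<integral>\<^sup>+x. ennreal (G x) \<partial>P) \<le> (\<integral>\<^sup>+y. ennreal (G y) \<partial>?Q)"
    by (rule sNA_pmf_le_independent[OF P le G_dcx G_mono]) (simp_all add: G_0)
  then have "(\<integral>x. G x \<partial>P) \<le> (\<integral>y. G y \<partial>?Q)"
    unfolding nn_integral_eq_integral[OF GP AE_P] nn_integral_eq_integral[OF GQ AE_Q]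
    using integral_nonneg_AE[OF AE_Q] by simp
  moreover have "(\<integral>x. G x \<partial>P) = (\<integral>x. F x \<partial>P) - (\<integral>x. L x \<partial>P)"
    unfolding G_def using F(2) L_P by (rule Bochner_Integration.integral_diff)
  moreover have "(\<integral>y. G y \<partial>?Q) = (\<integral>y. F y \<partial>?Q) - (\<integral>y. L y \<partial>?Q)"
    unfolding G_def using F(3) L_Q by (rule Bochner_Integration.integral_diff)
  ultimately show ?thesis using L_eq by linarith
qed

section \<open>Laws of random vectors of natural numbers\<close>

lemma measurable_grid_vector:
  assumes grid: "\<And>\<omega>. \<omega> \<in> space M \<Longrightarrow> V \<omega> \<in> grid n"
    and coord: "\<And>j. j \<in> {1..n} \<Longrightarrow> (\<lambda>\<omega>. V \<omega> j) \<in> measurable M (count_space UNIV)"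
  shows "V \<in> measurable M (count_space UNIV)"
proof -
  have "V \<in> measurable M (count_space (grid n))"
    unfolding measurable_count_space_eq_countable[OF countable_grid]
  proof (intro conjI ballI)
    fix a assume a: "a \<in> grid n"
    have "V -` {a} \<inter> space M = {\<omega>\<in>space M. \<forall>j\<in>{1..n}. V \<omega> j = a j}"
      using grid a by (fastforce simp: grid_def fun_eq_iff)
    also have "\<dots> \<in> sets M"
      using coord by (intro sets.sets_Collect_finite_All pred_eq_const1) auto
    finally show "V -` {a} \<inter> space M \<in> sets M" .
  qed (use grid in auto)
  then show ?thesis
    by (rule measurable_compose[where f = V and g = "\<lambda>x. x", simplified]) simp
qed

text \<open>
  Since the grid is countable, the law is discrete. Working with it as a \<open>pmf\<close> makes
  every function of the vector measurable, as test functions need not be Borel.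
\<close>

lemma (in prob_space) law_of_grid_vector:
  assumes V: "V \<in> measurable M (count_space UNIV)" and grid: "\<And>\<omega>. \<omega> \<in> space M \<Longrightarrow> V \<omega> \<in> grid n"
  obtains P where "measure_pmf P = distr M (count_space UNIV) V" "set_pmf P \<subseteq> grid n"
proof -
  let ?D = "distr M (count_space UNIV) V"
  interpret D: prob_space ?D
    using V by (rule prob_space_distr)
  have AE: "AE x in ?D. x \<in> grid n"
    using grid V by (simp add: AE_distr_iff)
  then have "AE x in ?D. measure ?D {x} \<noteq> 0"
    using countable_grid by (subst D.AE_support_countable) auto
  then have eq: "measure_pmf (Abs_pmf ?D) = ?D"
    by (intro Abs_pmf_inverse) (simp add: D.prob_space_axioms)
  moreover have "AE x in measure_pmf (Abs_pmf ?D). x \<in> grid n"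
    unfolding eq by (rule AE)
  then have "set_pmf (Abs_pmf ?D) \<subseteq> grid n"
    by (auto simp: AE_measure_pmf_iff)
  ultimately show ?thesis by (rule that)
qed

text \<open>
  The covariance inequality is applied to the bounded truncations of \<open>h\<close>, for which the
  covariance exists, and monotone convergence removes the bound. A function on the grid becomes
  a monotone function of real vectors by rounding the arguments down.
\<close>

lemma sNA_pmf_if_sNA_vector:
  fixes P :: "(nat \<Rightarrow> nat) pmf"
  assumes V: "V \<in> measurable M (count_space UNIV)"
    and law: "measure_pmf P = distr M (count_space UNIV) V" "set_pmf P \<subseteq> grid n"
    and X: "\<And>\<omega> j. \<omega> \<in> space M \<Longrightarrow> j \<in> {1..n} \<Longrightarrow> X j \<omega> = real (V \<omega> j)"
    and grid: "\<And>\<omega>. \<omega> \<in> space M \<Longrightarrow> V \<omega> \<in> grid n"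
    and sNA: "sNA_vector M n X"
  shows "sNA_pmf n P"
  unfolding sNA_pmf_def
proof (intro ballI allI impI)
  fix i t and h :: "(nat \<Rightarrow> nat) \<Rightarrow> ennreal"
  assume i: "i \<in> {1..n}" and h: "mono_on (grid n) h"
  let ?I = "\<lambda>x :: nat \<Rightarrow> nat. indicator {t<..} (x i)"
  let ?T = "graft i (\<lambda>_. 0)"
  show "(\<integral>\<^sup>+x. ?I x * h (?T x) \<partial>P) \<le> (\<integral>\<^sup>+x. ?I x \<partial>P) * (\<integral>\<^sup>+x. h (?T x) \<partial>P)"
  proof (cases "i = n")
    \<comment> \<open>The last coordinate has no later ones: there the test function is constant.\<close>
    case True
    have T0: "AE x in P. h (?T x) = h (\<lambda>_. 0)"
      unfolding AE_measure_pmf_iff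
    proof
      fix x assume "x \<in> set_pmf P"
      then have "?T x = (\<lambda>_. 0)"
        using law(2) True by (auto simp: graft_def grid_def fun_eq_iff)
      then show "h (?T x) = h (\<lambda>_. 0)" by simp
    qed
    have "(\<integral>\<^sup>+x. ?I x * h (?T x) \<partial>P) = (\<integral>\<^sup>+x. ?I x * h (\<lambda>_. 0) \<partial>P)"
      using T0 by (intro nn_integral_cong_AE) auto
    moreover have "(\<integral>\<^sup>+x. h (?T x) \<partial>P) = (\<integral>\<^sup>+x. h (\<lambda>_. 0) \<partial>P)"
      using T0 by (intro nn_integral_cong_AE) auto
    ultimately show ?thesis
      by (simp add: nn_integral_multc measure_pmf.emeasure_space_1[simplified])
  next
    case False
    then have i': "i \<in> {1..<n}" using i by auto
    have bounded: "(\<integral>\<^sup>+x. ?I x * min (of_nat m) (h (?T x)) \<partial>P)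
        \<le> (\<integral>\<^sup>+x. ?I x \<partial>P) * (\<integral>\<^sup>+x. h (?T x) \<partial>P)" for m
    proof -
      define g where "g x = enn2real (min (of_nat m) (h x))" for x
      have g: "ennreal (g x) = min (of_nat m) (h x)" for x
        unfolding g_def by (rule ennreal_enn2real) (auto simp: min_less_iff_disj of_nat_less_top)
      have g_bounds: "0 \<le> g x" "g x \<le> m" for x
        by (auto simp: g_def enn2real_leI min.coboundedI1 ennreal_of_nat_eq_real_of_nat)
      define f where "f v = g (\<lambda>j. if j \<in> {i+1..n} then nat \<lfloor>v j\<rfloor> else 0)" for v :: "nat \<Rightarrow> real"
      have f_mono: "mono_on ({i+1..n} \<rightarrow>\<^sub>E UNIV) f"
      proof (rule mono_onI)
        fix v w :: "nat \<Rightarrow> real" assume "v \<le> w"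
        then have "h (\<lambda>j. if j \<in> {i+1..n} then nat \<lfloor>v j\<rfloor> else 0) \<le> h (\<lambda>j. if j \<in> {i+1..n} then nat \<lfloor>w j\<rfloor> else 0)"
          by (intro mono_onD[OF h]) (auto simp: grid_def le_fun_def intro!: nat_mono floor_mono)
        then show "f v \<le> f w"
          unfolding f_def g_def by (intro enn2real_mono) (auto simp: min.coboundedI2 min_less_iff_disj of_nat_less_top)
      qed
      have f_X: "f (\<lambda>j\<in>{i+1..n}. X j \<omega>) = g (?T (V \<omega>))" if "\<omega> \<in> space M" for \<omega>
      proof -
        have "(\<lambda>j. if j \<in> {i+1..n} then nat \<lfloor>(\<lambda>j\<in>{i+1..n}. X j \<omega>) j\<rfloor> else 0) = ?T (V \<omega>)"
          using X[OF that] grid[OF that] by (force simp: graft_def grid_def)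
        then show ?thesis unfolding f_def by (rule arg_cong)
      qed
      have I_X: "indicator {real t<..} (X i \<omega>) = (?I (V \<omega>) :: real)" if "\<omega> \<in> space M" for \<omega>
        using X[OF that i] by (simp add: indicator_def)
      have integrable_P: "integrable P (\<lambda>x. ?I x :: real)" "integrable P (\<lambda>x. g (?T x))"
        "integrable P (\<lambda>x. ?I x * g (?T x))"
        using g_bounds
        by (auto intro!: measure_pmf.integrable_const_bound[where B = "max 1 (real m)"]
              simp: le_max_iff_disj split: split_indicator)
      have to_P: "(\<integral>\<omega>. u (V \<omega>) \<partial>M) = (\<integral>x. u x \<partial>P)" for u :: "(nat \<Rightarrow> nat) \<Rightarrow> real"
        using V by (simp add: law(1) integral_distr)
      have integrable_to_M: "integrable M (\<lambda>\<omega>. u (V \<omega>))" if "integrable P u" for u :: "(nat \<Rightarrow> nat) \<Rightarrow> real"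
        using V that by (simp add: law(1) integrable_distr_eq)
      have "cov_exists M (\<lambda>\<omega>. indicator {real t<..} (X i \<omega>)) (\<lambda>\<omega>. f (\<lambda>j\<in>{i+1..n}. X j \<omega>))"
        unfolding cov_exists_def
        using integrable_P[THEN integrable_to_M] f_X I_X
        by (simp cong: Bochner_Integration.integrable_cong del: One_nat_def Suc_eq_plus1 add_Suc_right add_0_right)
      then have "Cov M (\<lambda>\<omega>. indicator {real t<..} (X i \<omega>)) (\<lambda>\<omega>. f (\<lambda>j\<in>{i+1..n}. X j \<omega>)) \<le> 0"
        using sNA i' f_mono unfolding sNA_vector_def by blast
      then have "(\<integral>\<omega>. ?I (V \<omega>) * g (?T (V \<omega>)) \<partial>M) \<le> (\<integral>\<omega>. ?I (V \<omega>) \<partial>M) * (\<integral>\<omega>. g (?T (V \<omega>)) \<partial>M)"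
        unfolding Cov_def
        by (simp add: f_X I_X cong: Bochner_Integration.integral_cong del: One_nat_def Suc_eq_plus1 add_Suc_right add_0_right)
      then have "(\<integral>x. ?I x * g (?T x) \<partial>P) \<le> (\<integral>x. ?I x \<partial>P) * (\<integral>x. g (?T x) \<partial>P)"
        by (simp only: to_P[of "\<lambda>x. ?I x * g (?T x)"] to_P[of ?I] to_P[of "\<lambda>x. g (?T x)"])
      then have "ennreal (\<integral>x. ?I x * g (?T x) \<partial>P) \<le> ennreal (\<integral>x. ?I x \<partial>P) * ennreal (\<integral>x. g (?T x) \<partial>P)"
        using g_bounds by (simp flip: ennreal_mult'' add: integral_nonneg_AE)
      then have "(\<integral>\<^sup>+x. ennreal (?I x * g (?T x)) \<partial>P) \<le> (\<integral>\<^sup>+x. ennreal (?I x) \<partial>P) * (\<integral>\<^sup>+x. ennreal (g (?T x)) \<partial>P)"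
        using g_bounds integrable_P by (simp add: nn_integral_eq_integral)
      then have "(\<integral>\<^sup>+x. ?I x * min (of_nat m) (h (?T x)) \<partial>P) \<le> (\<integral>\<^sup>+x. ?I x \<partial>P) * (\<integral>\<^sup>+x. min (of_nat m) (h (?T x)) \<partial>P)"
        using g_bounds by (simp add: ennreal_mult' g ennreal_indicator)
      also have "\<dots> \<le> (\<integral>\<^sup>+x. ?I x \<partial>P) * (\<integral>\<^sup>+x. h (?T x) \<partial>P)"
        by (intro mult_left_mono nn_integral_mono) auto
      finally show ?thesis .
    qed
    have sup: "(SUP m. ?I x * min (of_nat m) (h (?T x))) = ?I x * h (?T x)" for x
    proof -
      have "(SUP m. min (of_nat m) (h (?T x))) = min (SUP m. of_nat m) (h (?T x))"
        unfolding inf_min[symmetric] by (rule SUP_inf[symmetric]) 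
      then show ?thesis
        by (simp add: SUP_mult_left_ennreal[symmetric] ennreal_SUP_of_nat_eq_top)
    qed
    have "(\<integral>\<^sup>+x. ?I x * h (?T x) \<partial>P) = (SUP m. \<integral>\<^sup>+x. ?I x * min (of_nat m) (h (?T x)) \<partial>P)"
      unfolding sup[symmetric]
      by (intro nn_integral_monotone_convergence_SUP)
        (auto simp: incseq_def le_fun_def intro!: mult_left_mono min.mono)
    also have "\<dots> \<le> (\<integral>\<^sup>+x. ?I x \<partial>P) * (\<integral>\<^sup>+x. h (?T x) \<partial>P)"
      by (intro SUP_least bounded)
    finally show ?thesis .
  qed
qed

section \<open>Convex order and the Poisson distribution\<close>

lemma integrable_Po: "integrable (measure_pmf (Po r)) real"
proof (cases "0 < r")
  case True
  \<comment> \<open>Shifting the index cancels the factor k against the factorial and leaves an exponential series.\<close>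
  have "(\<lambda>k. pmf (poisson_pmf r) (Suc k) * real (Suc k)) = (\<lambda>k. (r * exp (- r)) * (r ^ k /\<^sub>R fact k))"
    using True by (simp add: fun_eq_iff field_simps del: of_nat_Suc)
  then have "summable (\<lambda>k. pmf (poisson_pmf r) (Suc k) * real (Suc k))"
    by (simp only: summable_mult summable_exp_generic)
  then have "summable (\<lambda>k. pmf (poisson_pmf r) k * real k)"
    by (subst (asm) summable_Suc_iff)
  then have "integrable (count_space UNIV) (\<lambda>k. pmf (poisson_pmf r) k * real k)"
    using True by (simp add: integrable_count_space_nat_iff abs_mult)
  then show ?thesis
    using True by (simp add: Po_def measure_pmf_eq_density integrable_density)
next
  case False
  then show ?thesis
    by (simp add: Po_def integrable_measure_pmf_finite)
qed

lemma convex_on_excess: "convex_on UNIV (\<lambda>x :: real. max 0 (x - a))"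
proof (rule convex_onI)
  fix t x y :: real assume t: "0 < t" "t < 1"
  have "0 \<le> t * max 0 (y - a)" "0 \<le> (1 - t) * max 0 (x - a)"
    "t * (y - a) \<le> t * max 0 (y - a)" "(1 - t) * (x - a) \<le> (1 - t) * max 0 (x - a)"
    using t by (auto intro: mult_left_mono)
  moreover have "(1 - t) *\<^sub>R x + t *\<^sub>R y - a = (1 - t) * (x - a) + t * (y - a)"
    by (simp add: algebra_simps)
  ultimately show "max 0 ((1 - t) *\<^sub>R x + t *\<^sub>R y - a) \<le> (1 - t) * max 0 (x - a) + t * max 0 (y - a)"
    by linarith
qed simp

text \<open>
  The test functions \<open>x\<close> and \<open>-x\<close> give the equality of the means, \<open>(x - k)\<^sup>+\<close> gives the
  stop-loss inequality. Integrability of both variables makes all these test functions admissible.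
\<close>

lemma cx_less_nat:
  fixes U :: "'w \<Rightarrow> nat" and W :: "'v \<Rightarrow> nat"
  assumes cx: "cx_less M (\<lambda>\<omega>. real (U \<omega>)) N (\<lambda>\<omega>. real (W \<omega>))"
    and U: "integrable M (\<lambda>\<omega>. real (U \<omega>))" and W: "integrable N (\<lambda>\<omega>. real (W \<omega>))"
  shows mean_eq_if_cx_less: "(\<integral>\<omega>. real (U \<omega>) \<partial>M) = (\<integral>\<omega>. real (W \<omega>) \<partial>N)"
    and stop_loss_le_if_cx_less: "(\<integral>\<^sup>+\<omega>. of_nat (U \<omega> - k) \<partial>M) \<le> (\<integral>\<^sup>+\<omega>. of_nat (W \<omega> - k) \<partial>N)"
proof -
  have le: "(\<integral>\<omega>. \<psi> (real (U \<omega>)) \<partial>M) \<le> (\<integral>\<omega>. \<psi> (real (W \<omega>)) \<partial>N)"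
    if "convex_on UNIV \<psi>" "integrable M (\<lambda>\<omega>. \<psi> (real (U \<omega>)))" "integrable N (\<lambda>\<omega>. \<psi> (real (W \<omega>)))" for \<psi>
    using cx that unfolding cx_less_def by blast
  show "(\<integral>\<omega>. real (U \<omega>) \<partial>M) = (\<integral>\<omega>. real (W \<omega>) \<partial>N)"
    using le[of "\<lambda>x. x"] le[of "\<lambda>x. - x"] U W
    by (simp add: convex_on_ident concave_on_def[symmetric] concave_on_ident)
  have excess: "max 0 (real m - real k) = real (m - k)" for m by simp
  have excess_U: "integrable M (\<lambda>\<omega>. real (U \<omega> - k))"
  proof (rule Bochner_Integration.integrable_bound[OF U])
    have "(\<lambda>\<omega>. max 0 (real (U \<omega>) - real k)) \<in> borel_measurable M"
      using borel_measurable_integrable[OF U] by simp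
    then show "(\<lambda>\<omega>. real (U \<omega> - k)) \<in> borel_measurable M" by (simp only: excess)
  qed auto
  have excess_W: "integrable N (\<lambda>\<omega>. real (W \<omega> - k))"
  proof (rule Bochner_Integration.integrable_bound[OF W])
    have "(\<lambda>\<omega>. max 0 (real (W \<omega>) - real k)) \<in> borel_measurable N"
      using borel_measurable_integrable[OF W] by simp
    then show "(\<lambda>\<omega>. real (W \<omega> - k)) \<in> borel_measurable N" by (simp only: excess)
  qed auto
  have "(\<integral>\<omega>. real (U \<omega> - k) \<partial>M) \<le> (\<integral>\<omega>. real (W \<omega> - k) \<partial>N)"
    using le[OF convex_on_excess[of "real k"]] excess_U excess_W by (simp only: excess)
  then show "(\<integral>\<^sup>+\<omega>. of_nat (U \<omega> - k) \<partial>M) \<le> (\<integral>\<^sup>+\<omega>. of_nat (W \<omega> - k) \<partial>N)"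
    by (simp add: ennreal_of_nat_eq_real_of_nat nn_integral_eq_integral excess_U excess_W ennreal_leI)
qed

section \<open>Count vectors of point processes\<close>

text \<open>
  On the sample space, \<^const>\<open>measure\<close> only takes natural values here (an infinite count is
  sent to \<open>0\<close>), so rounding down loses nothing.
\<close>

definition count_vector :: "('w \<Rightarrow> 'a::topological_space measure) \<Rightarrow> (nat \<Rightarrow> 'a set) \<Rightarrow> nat \<Rightarrow> 'w \<Rightarrow> nat \<Rightarrow> nat" where
  "count_vector \<eta> B n \<omega> = (\<lambda>j. if j \<in> {1..n} then nat \<lfloor>measure (\<eta> \<omega>) (B j)\<rfloor> else 0)"

lemma count_vector_in_grid: "count_vector \<eta> B n \<omega> \<in> grid n"
  by (auto simp: count_vector_def grid_def)

lemma real_count_vector: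
  assumes "point_process M \<eta>" "\<omega> \<in> space M" "j \<in> {1..n}" "B j \<in> sets borel"
  shows "real (count_vector \<eta> B n \<omega> j) = measure (\<eta> \<omega>) (B j)"
proof -
  have "emeasure (\<eta> \<omega>) (B j) \<in> range of_nat \<union> {\<infinity>}"
    using assms(1,2,4) by (simp add: point_process_def)
  then have "measure (\<eta> \<omega>) (B j) \<in> range real"
    by (auto simp: measure_def ennreal_of_nat_eq_real_of_nat intro: range_eqI[of _ _ 0])
  then obtain k where "measure (\<eta> \<omega>) (B j) = real k" by blast
  then show ?thesis
    using assms(3) by (simp add: count_vector_def)
qed

lemma measurable_count_vector:
  assumes "point_process M \<eta>" "\<And>j. j \<in> {1..n} \<Longrightarrow> B j \<in> sets borel"
  shows "count_vector \<eta> B n \<in> measurable M (count_space UNIV)"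
proof (rule measurable_grid_vector)
  fix j assume j: "j \<in> {1..n}"
  have "(\<lambda>\<omega>. emeasure (\<eta> \<omega>) (B j)) \<in> borel_measurable M"
    using assms j by (simp add: point_process_def)
  then have "(\<lambda>\<omega>. nat \<lfloor>measure (\<eta> \<omega>) (B j)\<rfloor>) \<in> measurable M (count_space UNIV)"
    unfolding measure_def by measurable
  then show "(\<lambda>\<omega>. count_vector \<eta> B n \<omega> j) \<in> measurable M (count_space UNIV)"
    using j by (simp add: count_vector_def)
qed (rule count_vector_in_grid)

text \<open>
  The Poisson weights sum to \<open>1\<close>, which leaves no mass for the count \<open>\<infinity>\<close>.
\<close>

lemma poisson_process_AE_finite:
  assumes "poisson_process N \<eta> \<Lambda>" "B \<in> sets borel" "emeasure \<Lambda> B < \<infinity>"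
  shows "AE \<omega> in N. emeasure (\<eta> \<omega>) B < \<infinity>"
proof -
  have pp: "point_process N \<eta>" using assms(1) by (simp add: poisson_process_def)
  interpret prob_space N using pp by (simp add: point_process_def)
  have [measurable]: "(\<lambda>\<omega>. emeasure (\<eta> \<omega>) B) \<in> borel_measurable N"
    using pp assms(2) by (simp add: point_process_def)
  let ?E = "\<lambda>k :: nat. {\<omega>\<in>space N. emeasure (\<eta> \<omega>) B = of_nat k}"
  have E: "measure N (?E k) = pmf (Po (measure \<Lambda> B)) k" for k
    using assms by (simp add: poisson_process_def)
  have "emeasure N (\<Union>k. ?E k) = (\<integral>\<^sup>+k. emeasure N (?E k) \<partial>count_space UNIV)"
    by (intro emeasure_UN_countable) (auto simp: disjoint_family_on_def)
  also have "\<dots> = 1"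
    using nn_integral_pmf[where p = "Po (measure \<Lambda> B)" and A = UNIV]
    by (simp add: emeasure_eq_measure E measure_pmf.emeasure_space_1[simplified])
  finally have "prob (\<Union>k. ?E k) = 1"
    by (simp add: measure_def)
  then have "AE \<omega> in N. \<omega> \<in> (\<Union>k. ?E k)"
    by (subst (asm) prob_eq_1) auto
  then show ?thesis
    by eventually_elim (auto simp: of_nat_less_top)
qed

text \<open>
  Both sides are discrete, so it suffices to compare point probabilities. The counts in
  the definition of the process may be infinite; off a null set they agree with the count vector,
  and there independence gives the product.
\<close>

lemma law_of_poisson_count_vector:
  assumes pois: "poisson_process N \<eta> \<Lambda>" and n: "1 \<le> n"
    and B: "\<And>j. j \<in> {1..n} \<Longrightarrow> B j \<in> sets borel" "disjoint_family_on B {1..n}"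
    and fin: "\<And>j. j \<in> {1..n} \<Longrightarrow> emeasure \<Lambda> (B j) < \<infinity>"
  shows "measure_pmf (Pi_pmf {1..n} 0 (\<lambda>j. Po (measure \<Lambda> (B j)))) = distr N (count_space UNIV) (count_vector \<eta> B n)"
proof -
  let ?V = "count_vector \<eta> B n" and ?Q = "Pi_pmf {1..n} 0 (\<lambda>j. Po (measure \<Lambda> (B j)))"
  have pp: "point_process N \<eta>" using pois by (simp add: poisson_process_def)
  interpret prob_space N using pp by (simp add: point_process_def)
  have V: "?V \<in> measurable N (count_space UNIV)"
    using pp B(1) by (rule measurable_count_vector)
  have meas: "(\<lambda>\<omega>. emeasure (\<eta> \<omega>) (B j)) \<in> borel_measurable N" if "j \<in> {1..n}" for j
    using pp B(1)[OF that] by (simp add: point_process_def)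
  have indep: "indep_vars (\<lambda>_. borel) (\<lambda>j \<omega>. emeasure (\<eta> \<omega>) (B j)) {1..n}"
    using pois B unfolding poisson_process_def by blast
  obtain P where P: "measure_pmf P = distr N (count_space UNIV) ?V" "set_pmf P \<subseteq> grid n"
    using law_of_grid_vector[OF V count_vector_in_grid] .
  have "P = ?Q"
  proof (rule pmf_eqI)
    fix y
    show "pmf P y = pmf ?Q y"
    proof (cases "y \<in> grid n")
      case True
      have "AE \<omega> in N. \<forall>j\<in>{1..n}. emeasure (\<eta> \<omega>) (B j) < \<infinity>"
        using poisson_process_AE_finite[OF pois] B(1) fin by (intro AE_finite_allI) auto
      then have AE: "AE \<omega> in N. (\<omega> \<in> ?V -` {y} \<inter> space N) =
          (\<omega> \<in> (\<Inter>j\<in>{1..n}. (\<lambda>\<omega>. emeasure (\<eta> \<omega>) (B j)) -` {of_nat (y j)} \<inter> space N))"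
        using AE_space
      proof eventually_elim
        fix \<omega> assume fin_\<omega>: "\<forall>j\<in>{1..n}. emeasure (\<eta> \<omega>) (B j) < \<infinity>" and \<omega>: "\<omega> \<in> space N"
        have "emeasure (\<eta> \<omega>) (B j) = of_nat (?V \<omega> j)" if "j \<in> {1..n}" for j
          using fin_\<omega> that real_count_vector[of N \<eta> \<omega> j n B, OF pp \<omega> that B(1)[OF that]]
          by (simp add: emeasure_eq_ennreal_measure ennreal_of_nat_eq_real_of_nat less_top[symmetric])
        then have "(\<forall>j\<in>{1..n}. emeasure (\<eta> \<omega>) (B j) = of_nat (y j)) \<longleftrightarrow> (\<forall>j\<in>{1..n}. ?V \<omega> j = y j)"
          by (auto simp: of_nat_eq_iff)
        also have "\<dots> \<longleftrightarrow> ?V \<omega> = y"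
          using True count_vector_in_grid[of \<eta> B n \<omega>] by (fastforce simp: grid_def fun_eq_iff)
        finally show "(\<omega> \<in> ?V -` {y} \<inter> space N) =
          (\<omega> \<in> (\<Inter>j\<in>{1..n}. (\<lambda>\<omega>. emeasure (\<eta> \<omega>) (B j)) -` {of_nat (y j)} \<inter> space N))"
          using \<omega> n by auto
      qed
      have "pmf P y = prob (?V -` {y} \<inter> space N)"
        using V by (simp add: pmf.rep_eq P(1) measure_distr)
      also have "\<dots> = prob (\<Inter>j\<in>{1..n}. (\<lambda>\<omega>. emeasure (\<eta> \<omega>) (B j)) -` {of_nat (y j)} \<inter> space N)"
        using AE V meas n by (intro finite_measure_eq_AE sets.finite_INT measurable_sets[OF meas]) (auto intro: measurable_sets)
      also have "\<dots> = (\<Prod>j\<in>{1..n}. prob ((\<lambda>\<omega>. emeasure (\<eta> \<omega>) (B j)) -` {of_nat (y j)} \<inter> space N))"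
        using n by (intro indep_varsD_finite[OF indep]) auto
      also have "\<dots> = (\<Prod>j\<in>{1..n}. pmf (Po (measure \<Lambda> (B j))) (y j))"
      proof (rule prod.cong[OF refl])
        fix j assume j: "j \<in> {1..n}"
        have "(\<lambda>\<omega>. emeasure (\<eta> \<omega>) (B j)) -` {of_nat (y j)} \<inter> space N
            = {\<omega>\<in>space N. emeasure (\<eta> \<omega>) (B j) = of_nat (y j)}" by auto
        then show "prob ((\<lambda>\<omega>. emeasure (\<eta> \<omega>) (B j)) -` {of_nat (y j)} \<inter> space N) = pmf (Po (measure \<Lambda> (B j))) (y j)"
          using pois B(1)[OF j] fin[OF j] by (simp add: poisson_process_def)
      qed
      also have "\<dots> = pmf ?Q y"
        using True by (intro pmf_Pi'[symmetric]) (auto simp: grid_def)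
      finally show ?thesis .
    next
      case False
      then have "pmf P y = 0"
        using P(2) by (auto simp: set_pmf_iff)
      moreover have "pmf ?Q y = 0"
        using False by (intro pmf_Pi_outside) (auto simp: grid_def)
      ultimately show ?thesis by simp
    qed
  qed
  then show ?thesis using P(1) by simp
qed

section \<open>The comparison theorem\<close>

theorem proposition4p7:
  fixes M :: "'w measure" and N :: "'v measure"
    and \<eta>\<^sub>1 :: "'w \<Rightarrow> 'a::polish_space measure" and \<eta>\<^sub>2 :: "'v \<Rightarrow> 'a measure"
  assumes "finite_point_process M \<eta>\<^sub>1"
    and "sNA_process M \<eta>\<^sub>1"
    and "\<And>B. B \<in> sets borel \<Longrightarrow> bounded B \<Longrightarrow>
           emeasure (intensity_measure M \<eta>\<^sub>1) B < \<infinity> \<and>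
           cx_less M (\<lambda>\<omega>. measure (\<eta>\<^sub>1 \<omega>) B)
             (measure_pmf (Po (measure (intensity_measure M \<eta>\<^sub>1) B))) real"
    and "poisson_process N \<eta>\<^sub>2 (intensity_measure M \<eta>\<^sub>1)"
  shows "dcx_less_process M \<eta>\<^sub>1 N \<eta>\<^sub>2"
  unfolding dcx_less_process_def
proof (intro allI impI)
  fix n :: nat and B :: "nat \<Rightarrow> 'a set"
  assume n: "1 \<le> n" and "\<forall>i\<in>{1..n}. B i \<in> sets borel \<and> bounded (B i)"
    and disj: "disjoint_family_on B {1..n}"
  then have B: "\<And>j. j \<in> {1..n} \<Longrightarrow> B j \<in> sets borel" "\<And>j. j \<in> {1..n} \<Longrightarrow> bounded (B j)" by auto
  define \<Lambda> where "\<Lambda> = intensity_measure M \<eta>\<^sub>1"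
  let ?V = "count_vector \<eta>\<^sub>1 B n" and ?W = "count_vector \<eta>\<^sub>2 B n"
  let ?p = "\<lambda>j. Po (measure \<Lambda> (B j))"
  let ?Q = "Pi_pmf {1..n} 0 ?p"
  have pp1: "point_process M \<eta>\<^sub>1" and finite1: "AE \<omega> in M. emeasure (\<eta>\<^sub>1 \<omega>) UNIV < \<infinity>"
    using assms(1) by (auto simp: finite_point_process_def)
  have pp2: "point_process N \<eta>\<^sub>2" using assms(4) by (simp add: poisson_process_def)
  interpret prob_space M using pp1 by (simp add: point_process_def)
  have AE1: "AE \<omega> in M. emeasure (\<eta>\<^sub>1 \<omega>) (B j) < \<infinity>" if "j \<in> {1..n}" for j
    using finite1 AE_space
  proof eventually_elim
    fix \<omega> assume "emeasure (\<eta>\<^sub>1 \<omega>) UNIV < \<infinity>" "\<omega> \<in> space M"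
    then show "emeasure (\<eta>\<^sub>1 \<omega>) (B j) < \<infinity>"
      using pp1 emeasure_mono[of "B j" UNIV "\<eta>\<^sub>1 \<omega>"]
      by (auto simp: point_process_def intro: le_less_trans)
  qed
  have fin: "emeasure \<Lambda> (B j) < \<infinity>" if "j \<in> {1..n}" for j
    using assms(3)[OF B[OF that]] by (simp add: \<Lambda>_def)
  have AE2: "AE \<omega> in N. emeasure (\<eta>\<^sub>2 \<omega>) (B j) < \<infinity>" if "j \<in> {1..n}" for j
    using assms(4) B(1)[OF that] fin[OF that] unfolding \<Lambda>_def by (rule poisson_process_AE_finite)
  have V: "?V \<in> measurable M (count_space UNIV)"
    using pp1 B(1) by (rule measurable_count_vector)
  have W: "?W \<in> measurable N (count_space UNIV)"
    using pp2 B(1) by (rule measurable_count_vector)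
  have V_eq: "real (?V \<omega> j) = measure (\<eta>\<^sub>1 \<omega>) (B j)" if "\<omega> \<in> space M" "j \<in> {1..n}" for \<omega> j
    using pp1 that B(1)[OF that(2)] by (rule real_count_vector)
  have W_eq: "real (?W \<omega> j) = measure (\<eta>\<^sub>2 \<omega>) (B j)" if "\<omega> \<in> space N" "j \<in> {1..n}" for \<omega> j
    using pp2 that B(1)[OF that(2)] by (rule real_count_vector)
  obtain P where P: "measure_pmf P = distr M (count_space UNIV) ?V" "set_pmf P \<subseteq> grid n"
    using law_of_grid_vector[OF V count_vector_in_grid] .
  have Q: "measure_pmf ?Q = distr N (count_space UNIV) ?W"
    using assms(4) n B(1) disj fin unfolding \<Lambda>_def by (rule law_of_poisson_count_vector)
  have sNA: "sNA_pmf n P"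
  proof (rule sNA_pmf_if_sNA_vector[OF V P])
    show "sNA_vector M n (\<lambda>j \<omega>. measure (\<eta>\<^sub>1 \<omega>) (B j))"
      using assms(2) B(1) disj unfolding sNA_process_def by blast
  qed (simp_all add: V_eq count_vector_in_grid)
  have int_V: "integrable M (\<lambda>\<omega>. real (?V \<omega> j))" if j: "j \<in> {1..n}" for j
  proof (rule integrableI_bounded)
    show "(\<lambda>\<omega>. real (?V \<omega> j)) \<in> borel_measurable M"
      using measurable_compose[OF V, of "\<lambda>x. real (x j)" borel] by simp
    have "(\<integral>\<^sup>+\<omega>. ennreal (norm (real (?V \<omega> j))) \<partial>M) \<le> (\<integral>\<^sup>+\<omega>. emeasure (\<eta>\<^sub>1 \<omega>) (B j) \<partial>M)"
    proof (rule nn_integral_mono)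
      fix \<omega> assume "\<omega> \<in> space M"
      then show "ennreal (norm (real (?V \<omega> j))) \<le> emeasure (\<eta>\<^sub>1 \<omega>) (B j)"
        using V_eq[OF _ j] by (cases "emeasure (\<eta>\<^sub>1 \<omega>) (B j) = \<infinity>") (auto simp: emeasure_eq_ennreal_measure)
    qed
    also have "\<dots> = emeasure \<Lambda> (B j)"
      using emeasure_intensity_measure[OF pp1 B(1)[OF j]] by (simp add: \<Lambda>_def)
    finally show "(\<integral>\<^sup>+\<omega>. ennreal (norm (real (?V \<omega> j))) \<partial>M) < \<infinity>"
      using fin[OF j] by (rule le_less_trans)
  qed
  have cx: "cx_less M (\<lambda>\<omega>. real (?V \<omega> j)) (?p j) real" if "j \<in> {1..n}" for j
    using assms(3)[OF B[OF that]] that V_eq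
    by (simp add: cx_less_def \<Lambda>_def cong: Bochner_Integration.integral_cong Bochner_Integration.integrable_cong)
  have transfer_P: "(\<integral>\<omega>. F (?V \<omega>) \<partial>M) = (\<integral>x. F x \<partial>P)"
      "integrable M (\<lambda>\<omega>. F (?V \<omega>)) \<longleftrightarrow> integrable P F" for F :: "(nat \<Rightarrow> nat) \<Rightarrow> real"
    using V by (simp_all add: P(1) integral_distr integrable_distr_eq)
  have transfer_Q: "(\<integral>\<omega>. F (?W \<omega>) \<partial>N) = (\<integral>y. F y \<partial>?Q)"
      "integrable N (\<lambda>\<omega>. F (?W \<omega>)) \<longleftrightarrow> integrable ?Q F" for F :: "(nat \<Rightarrow> nat) \<Rightarrow> real"
    unfolding Q using W by (simp_all add: integral_distr integrable_distr_eq)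
  have "dcx_less_vector n M (\<lambda>j \<omega>. measure (\<eta>\<^sub>1 \<omega>) (B j)) N (\<lambda>j \<omega>. measure (\<eta>\<^sub>2 \<omega>) (B j))"
    unfolding dcx_less_vector_def
  proof (intro allI impI)
    fix f :: "(nat \<Rightarrow> real) \<Rightarrow> real"
    define F where "F x = f (\<lambda>j\<in>{1..n}. real (x j))" for x :: "nat \<Rightarrow> nat"
    have F_V: "f (\<lambda>j\<in>{1..n}. measure (\<eta>\<^sub>1 \<omega>) (B j)) = F (?V \<omega>)" if "\<omega> \<in> space M" for \<omega>
      unfolding F_def using V_eq[OF that] by (intro arg_cong[where f = f]) (simp add: restrict_def fun_eq_iff)
    have F_W: "f (\<lambda>j\<in>{1..n}. measure (\<eta>\<^sub>2 \<omega>) (B j)) = F (?W \<omega>)" if "\<omega> \<in> space N" for \<omega>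
      unfolding F_def using W_eq[OF that] by (intro arg_cong[where f = f]) (simp add: restrict_def fun_eq_iff)
    assume f: "directionally_convex n f"
      and "integrable M (\<lambda>\<omega>. f (\<lambda>j\<in>{1..n}. measure (\<eta>\<^sub>1 \<omega>) (B j)))"
      and "integrable N (\<lambda>\<omega>. f (\<lambda>j\<in>{1..n}. measure (\<eta>\<^sub>2 \<omega>) (B j)))"
    then have "integrable M (\<lambda>\<omega>. F (?V \<omega>))" "integrable N (\<lambda>\<omega>. F (?W \<omega>))"
      by (simp_all only: F_V F_W cong: Bochner_Integration.integrable_cong)
    then have F: "integrable P F" "integrable ?Q F"
      by (simp_all only: transfer_P transfer_Q)
    have "(\<integral>x. F x \<partial>P) \<le> (\<integral>y. F y \<partial>?Q)"
    proof (rule sNA_pmf_dcx_le_independent[OF P(2) sNA])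
      fix i assume i: "i \<in> {1..n}"
      show "integrable P (\<lambda>x. real (x i))"
        using int_V[OF i] by (simp only: transfer_P(2)[of "\<lambda>x. real (x i)"])
      show "integrable (?p i) real" by (rule integrable_Po)
      show "(\<integral>x. real (x i) \<partial>P) = (\<integral>z. real z \<partial>?p i)"
        using mean_eq_if_cx_less[OF cx[OF i] int_V[OF i] integrable_Po]
        by (simp only: transfer_P(1)[of "\<lambda>x. real (x i)"])
      show "(\<integral>\<^sup>+x. of_nat (x i - k) \<partial>P) \<le> (\<integral>\<^sup>+z. of_nat (z - k) \<partial>?p i)" for k
        using stop_loss_le_if_cx_less[OF cx[OF i] int_V[OF i] integrable_Po, of k] V
        by (simp add: P(1) nn_integral_distr)
    next
      show "grid_dcx n F"
        unfolding F_def using f by (rule grid_dcx_if_directionally_convex)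
    qed (use F in auto)
    then have "(\<integral>\<omega>. F (?V \<omega>) \<partial>M) \<le> (\<integral>\<omega>. F (?W \<omega>) \<partial>N)"
      by (simp only: transfer_P transfer_Q)
    then show "(\<integral>\<omega>. f (\<lambda>j\<in>{1..n}. measure (\<eta>\<^sub>1 \<omega>) (B j)) \<partial>M) \<le> (\<integral>\<omega>. f (\<lambda>j\<in>{1..n}. measure (\<eta>\<^sub>2 \<omega>) (B j)) \<partial>N)"
      by (simp only: F_V F_W cong: Bochner_Integration.integral_cong)
  qed
  then show "(\<forall>i\<in>{1..n}. AE \<omega> in M. emeasure (\<eta>\<^sub>1 \<omega>) (B i) < \<infinity>) \<and>
      (\<forall>i\<in>{1..n}. AE \<omega> in N. emeasure (\<eta>\<^sub>2 \<omega>) (B i) < \<infinity>) \<and>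
      dcx_less_vector n M (\<lambda>i \<omega>. measure (\<eta>\<^sub>1 \<omega>) (B i)) N (\<lambda>i \<omega>. measure (\<eta>\<^sub>2 \<omega>) (B i))"
    using AE1 AE2 by blast
qed

end
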